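(* Let $\mathcal E$ be a sphere of radius $r$ contained inside a sphere $\mathcal B$ of radius $R$ in $\mathbb R^3$. Let $d$ be the distance between the centres of $\mathcal E$ and $\mathcal B$. The sole necessary and sufficient condition for the existence of a tetrahedron circumscribed about $\mathcal E$ and inscribed in $\mathcal B$ is $$d^2\le (R+r)(R-3r).$$
   Context: This is the Grace-Danielsson inequality. "Contained inside $\mathcal B$" means contained in the closed ball bounded by $\mathcal B$. The terms "circumscribed about" and "inscribed in" are used in their usual sense in Euclidean geometry. *)

theory Defs
  imports "HOL-Analysis.Analysis"
begin

text \<open>
  Tetrahedra are solid: a tetrahedron is a set \<open>T\<close> with \<open>3 simplex T\<close>, its vertices being the
  extreme points and its faces the facets.
\<close>

definition inscribed_in :: "'a::euclidean_space set \<Rightarrow> 'a set \<Rightarrow> bool" where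
  "inscribed_in T S \<longleftrightarrow> {v. v extreme_point_of T} \<subseteq> S"

text \<open>
  \<open>T\<close> is circumscribed about the sphere \<open>S\<close> if \<open>S\<close> lies in \<open>T\<close> and every facet is tangent to
  \<open>S\<close>: the plane of the facet meets \<open>S\<close> in exactly one point, and that point lies on the facet.
  Since \<open>S \<subseteq> T\<close>, only the insphere qualifies, not the exspheres.
\<close>

definition circumscribed_about :: "'a::euclidean_space set \<Rightarrow> 'a set \<Rightarrow> bool" where
  "circumscribed_about T S \<longleftrightarrow>
     S \<subseteq> T \<and> (\<forall>F. F facet_of T \<longrightarrow> (\<exists>p\<in>F. affine hull F \<inter> S = {p}))"

end

theory Submission
  imports Defs
begin

text \<open>
  Let \<open>\<alpha> v + \<beta> v \<bullet> (x - e)\<close> be the barycentric coordinates of a simplex with vertices \<open>v\<close>. The simplex is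
  circumscribed about the sphere iff \<open>\<alpha> v = r * norm (\<beta> v)\<close> for all \<open>v\<close>, so both \<open>(\<alpha> v, r *\<^sub>R \<beta> v)\<close> and,
  for an inscribed simplex, \<open>(R, v - b)\<close> are lightlike vectors of Minkowski space. Hence the
  latter has nonnegative product with every Lorentz boost of the former. Summing over the
  vertices, the barycentric identities turn this into a bound involving only \<open>r\<close>, \<open>R\<close> and \<open>d\<close>, and the
  best boost along the line of centres yields the inequality. Conversely, if the inequality holds,
  there is a tetrahedron with two opposite edges perpendicular to the line of centres and to each
  other, symmetric in the two planes through this line and one of these edges; its shape is
  given by a quadratic equation.
\<close>

section \<open>Barycentric coordinates of a simplex and tangency of its facets\<close>

text \<open>Moving another point \<open>a\<close> of \<open>C\<close> to the origin makes the
  remaining points linearly independent, so a linear functional can be prescribed on them; the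
  constant undoes the translation. The result is the barycentric coordinate of
  \<open>v\<close>.\<close>

lemma dual_functional:
  fixes C :: "'a::euclidean_space set"
  assumes "\<not> affine_dependent C" "v \<in> C"
  obtains \<alpha> \<beta> where "\<And>w. w \<in> C \<Longrightarrow> \<alpha> + \<beta> \<bullet> w = of_bool (w = v)"
proof (cases "C = {v}")
  case True
  then show ?thesis by (intro that[of 1 0]) auto
next
  case False
  then obtain a where a: "a \<in> C" "a \<noteq> v" using assms(2) by auto
  have "independent ((\<lambda>x. - a + x) ` (C - {a}))"
    using assms(1) affine_dependent_iff_dependent2[OF a(1)] by blast
  then obtain g :: "'a \<Rightarrow> real" where g: "linear g"
    "\<forall>x\<in>(\<lambda>x. - a + x) ` (C - {a}). g x = of_bool (x = v - a)"
    using linear_independent_extend[of _ "\<lambda>x. of_bool (x = v - a)"] by blast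
  define \<beta> where "\<beta> = adjoint g 1"
  have \<beta>: "\<beta> \<bullet> x = g x" for x
    using adjoint_works[OF g(1), of x 1] by (simp add: \<beta>_def inner_commute)
  have "- (\<beta> \<bullet> a) + \<beta> \<bullet> w = of_bool (w = v)" if "w \<in> C" for w
  proof (cases "w = a")
    case True
    with a show ?thesis by simp
  next
    case False
    with that g(2) have "g (- a + w) = of_bool (- a + w = v - a)" by blast
    then show ?thesis by (simp add: \<beta>[symmetric] inner_diff_right algebra_simps)
  qed
  then show ?thesis using that by blast
qed

text \<open>A dual functional applied to an affine dependence isolates a single coefficient and
  forces it to vanish. This later replaces a determinant for the constructed vertices.\<close>

lemma affine_independent_if_dual:
  fixes C :: "'a::real_inner set"
  assumes "finite C"
    and "\<And>v. v \<in> C \<Longrightarrow> \<exists>\<alpha> \<beta>. \<forall>w\<in>C. \<alpha> + \<beta> \<bullet> w = of_bool (w = v)"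
  shows "\<not> affine_dependent C"
proof
  assume "affine_dependent C"
  then obtain U v where U: "sum U C = 0" "v \<in> C" "U v \<noteq> 0" "(\<Sum>w\<in>C. U w *\<^sub>R w) = 0"
    using affine_dependent_explicit_finite[OF assms(1)] by auto
  obtain \<alpha> \<beta> where *: "\<forall>w\<in>C. \<alpha> + \<beta> \<bullet> w = of_bool (w = v)" using assms(2) U(2) by blast
  have "U v = (\<Sum>w\<in>C. U w * of_bool (w = v))"
    using assms(1) U(2) by (simp add: of_bool_def if_distrib cong: if_cong)
  also have "\<dots> = (\<Sum>w\<in>C. U w * (\<alpha> + \<beta> \<bullet> w))" using * by (intro sum.cong) auto
  also have "\<dots> = \<alpha> * sum U C + \<beta> \<bullet> (\<Sum>w\<in>C. U w *\<^sub>R w)"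
    by (simp add: inner_sum_right sum_distrib_left sum.distrib algebra_simps)
  finally show False using U by simp
qed

lemma affine_functional_sum:
  fixes e \<beta> :: "'a::real_inner"
  assumes "finite C" "sum u C = 1" "\<And>w. w \<in> C \<Longrightarrow> \<alpha> + \<beta> \<bullet> (w - e) = of_bool (w = v)" "v \<in> C"
  shows "\<alpha> + \<beta> \<bullet> ((\<Sum>w\<in>C. u w *\<^sub>R w) - e) = u v"
proof -
  have "u v = (\<Sum>w\<in>C. u w * of_bool (w = v))"
    using assms(1,4) by (simp add: of_bool_def if_distrib cong: if_cong)
  also have "\<dots> = (\<Sum>w\<in>C. u w * (\<alpha> + \<beta> \<bullet> (w - e)))" using assms(3) by (intro sum.cong) auto
  also have "\<dots> = (\<alpha> - \<beta> \<bullet> e) * sum u C + \<beta> \<bullet> (\<Sum>w\<in>C. u w *\<^sub>R w)"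
    by (simp add: inner_sum_right inner_diff_right sum_distrib_left sum_distrib_right sum.distrib sum_subtractf algebra_simps)
  finally show ?thesis using assms by (simp add: inner_diff_right)
qed

text \<open>The minimum on the sphere is \<open>\<alpha> - r * norm \<beta>\<close>, attained
  opposite to \<beta>. Nonnegativity there bounds \<alpha> from below; the zero at \<open>p\<close>
  bounds it from above by Cauchy-Schwarz.\<close>

lemma affine_functional_min_sphere:
  fixes e \<beta> :: "'a::euclidean_space"
  assumes "0 < r" "\<And>x. x \<in> sphere e r \<Longrightarrow> 0 \<le> \<alpha> + \<beta> \<bullet> (x - e)"
    and p: "p \<in> sphere e r" "\<alpha> + \<beta> \<bullet> (p - e) = 0"
  shows "\<alpha> = r * norm \<beta>"
proof (cases "\<beta> = 0")
  case True
  then show ?thesis using p by simp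
next
  case False
  have "0 \<le> \<alpha> + \<beta> \<bullet> ((e - (r / norm \<beta>) *\<^sub>R \<beta>) - e)"
    using False assms(1) by (intro assms(2)) (simp add: dist_norm)
  also have "\<dots> = \<alpha> - r * norm \<beta>"
    using False by (simp add: dot_square_norm power2_eq_square)
  finally have "r * norm \<beta> \<le> \<alpha>" by simp
  moreover have "\<bar>\<beta> \<bullet> (p - e)\<bar> \<le> norm \<beta> * r"
    using Cauchy_Schwarz_ineq2[of \<beta> "p - e"] p(1) by (simp add: dist_norm norm_minus_commute)
  ultimately show ?thesis using p(2) by (simp add: mult.commute)
qed

text \<open>A common point gives equality in Cauchy-Schwarz, which makes \<open>x - e\<close> a
  negative multiple of \<beta>.\<close>

lemma plane_inter_sphere:
  fixes e \<beta> :: "'a::euclidean_space"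
  assumes "0 < r" "\<beta> \<noteq> 0"
  shows "{x. r * norm \<beta> + \<beta> \<bullet> (x - e) = 0} \<inter> sphere e r = {e - (r / norm \<beta>) *\<^sub>R \<beta>}"
proof -
  have "x = e - (r / norm \<beta>) *\<^sub>R \<beta>"
    if "r * norm \<beta> + \<beta> \<bullet> (x - e) = 0" "x \<in> sphere e r" for x
  proof -
    have "norm (x - e) = r" using that(2) by (simp add: dist_norm norm_minus_commute)
    moreover from this have "- \<beta> \<bullet> (x - e) = norm (- \<beta>) * norm (x - e)"
      using that(1) by (simp add: mult.commute)
    ultimately have "r *\<^sub>R \<beta> = - norm \<beta> *\<^sub>R (x - e)"
      unfolding norm_cauchy_schwarz_eq by simp
    hence "(1 / norm \<beta>) *\<^sub>R (r *\<^sub>R \<beta>) = (1 / norm \<beta>) *\<^sub>R (- norm \<beta> *\<^sub>R (x - e))" by (rule arg_cong)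
    thus ?thesis using assms(2) by simp
  qed
  moreover have "r * norm \<beta> + \<beta> \<bullet> ((e - (r / norm \<beta>) *\<^sub>R \<beta>) - e) = 0"
    using assms by (simp add: dot_square_norm power2_eq_square)
  moreover have "e - (r / norm \<beta>) *\<^sub>R \<beta> \<in> sphere e r"
    using assms by (simp add: dist_norm)
  ultimately show ?thesis by blast
qed

text \<open>The plane of the facet opposite \<open>v\<close> is the zero set of the barycentric
  coordinate of \<open>v\<close>. A coordinate with gradient \<beta> and value
  \<open>r * norm \<beta>\<close> at \<open>e\<close> says that \<open>e\<close> has distance
  \<open>r\<close> from this plane, on the side of \<open>v\<close>. Tangency thus becomes a system
  of equations.\<close>

proposition circumscribed_simplex_iff:
  fixes e :: "'a::euclidean_space"
  assumes r: "0 < r" and C: "\<not> affine_dependent C" "card C = Suc (DIM('a))"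
  shows "circumscribed_about (convex hull C) (sphere e r) \<longleftrightarrow>
    (\<forall>v\<in>C. \<exists>\<beta>. \<forall>w\<in>C. r * norm \<beta> + \<beta> \<bullet> (w - e) = of_bool (w = v))"
proof -
  have fin: "finite C" using C(2) by (simp add: card_ge_0_finite)
  \<comment> \<open>A facet is nonempty by definition, so some vertex must remain when
    \<open>v\<close> is removed.\<close>
  have ne: "C - {v} \<noteq> {}" for v
  proof
    assume "C - {v} = {}"
    hence "card C \<le> card {v}" by (intro card_mono) auto
    thus False using C(2) by simp
  qed
  have facet: "F facet_of convex hull C \<longleftrightarrow> (\<exists>v\<in>C. F = convex hull (C - {v}))" for F
  proof -
    have "convex hull (C - {v}) \<noteq> {}" for v using ne by (simp only: convex_hull_eq_empty) simp
    then show ?thesis using facet_of_convex_hull_affine_independent[OF C(1), of F] by blast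
  qed
  have plane: "affine hull (C - {v}) = {x. \<alpha> + \<beta> \<bullet> (x - e) = 0}"
    and coord: "\<And>u. sum u C = 1 \<Longrightarrow> \<alpha> + \<beta> \<bullet> ((\<Sum>w\<in>C. u w *\<^sub>R w) - e) = u v"
    if v: "v \<in> C" and dual: "\<forall>w\<in>C. \<alpha> + \<beta> \<bullet> (w - e) = of_bool (w = v)" for v \<alpha> \<beta>
  proof -
    show coord: "\<alpha> + \<beta> \<bullet> ((\<Sum>w\<in>C. u w *\<^sub>R w) - e) = u v" if "sum u C = 1" for u
      using affine_functional_sum fin that v dual by blast
    have split: "sum f C = f v + sum f (C - {v})" for f :: "'a \<Rightarrow> 'b::comm_monoid_add"
      using fin v by (simp add: sum.remove)
    show "affine hull (C - {v}) = {x. \<alpha> + \<beta> \<bullet> (x - e) = 0}"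
    proof (intro subset_antisym subsetI)
      fix x assume "x \<in> affine hull (C - {v})"
      then obtain u where u: "sum u (C - {v}) = 1" "(\<Sum>w\<in>C - {v}. u w *\<^sub>R w) = x"
        using fin by (auto simp: affine_hull_finite)
      have "sum (u(v := 0)) C = 1" "(\<Sum>w\<in>C. (u(v := 0)) w *\<^sub>R w) = x"
        using u by (simp_all add: split)
      with coord[of "u(v := 0)"] show "x \<in> {x. \<alpha> + \<beta> \<bullet> (x - e) = 0}" by simp
    next
      fix x assume x: "x \<in> {x. \<alpha> + \<beta> \<bullet> (x - e) = 0}"
      have "x \<in> affine hull C" using affine_independent_span_eq[OF C] by simp
      then obtain u where u: "sum u C = 1" "(\<Sum>w\<in>C. u w *\<^sub>R w) = x"
        using fin by (auto simp: affine_hull_finite)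
      with coord[of u] x have "u v = 0" by simp
      with u have "sum u (C - {v}) = 1" "(\<Sum>w\<in>C - {v}. u w *\<^sub>R w) = x" by (simp_all add: split)
      then show "x \<in> affine hull (C - {v})" using fin by (auto simp: affine_hull_finite)
    qed
  qed
  show ?thesis
  proof
    assume circ: "circumscribed_about (convex hull C) (sphere e r)"
    show "\<forall>v\<in>C. \<exists>\<beta>. \<forall>w\<in>C. r * norm \<beta> + \<beta> \<bullet> (w - e) = of_bool (w = v)"
    proof
      fix v assume v: "v \<in> C"
      obtain \<alpha>' \<beta> where "\<And>w. w \<in> C \<Longrightarrow> \<alpha>' + \<beta> \<bullet> w = of_bool (w = v)"
        using dual_functional[OF C(1) v] by blast
      then have dual: "\<forall>w\<in>C. (\<alpha>' + \<beta> \<bullet> e) + \<beta> \<bullet> (w - e) = of_bool (w = v)"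
        by (simp add: inner_diff_right)
      have "convex hull (C - {v}) facet_of convex hull C" using facet v by blast
      then obtain p where "affine hull (convex hull (C - {v})) \<inter> sphere e r = {p}"
        using circ unfolding circumscribed_about_def by blast
      then have p: "affine hull (C - {v}) \<inter> sphere e r = {p}" by simp
      have "\<alpha>' + \<beta> \<bullet> e = r * norm \<beta>"
      proof (rule affine_functional_min_sphere[OF r])
        fix x assume "x \<in> sphere e r"
        then have "x \<in> convex hull C" using circ by (auto simp: circumscribed_about_def)
        then obtain u where u: "\<forall>w\<in>C. 0 \<le> u w" "sum u C = 1" "(\<Sum>w\<in>C. u w *\<^sub>R w) = x"
          using fin by (auto simp: convex_hull_finite)
        then show "0 \<le> (\<alpha>' + \<beta> \<bullet> e) + \<beta> \<bullet> (x - e)"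
          using coord[OF v dual, of u] v by simp
      next
        show "p \<in> sphere e r" "(\<alpha>' + \<beta> \<bullet> e) + \<beta> \<bullet> (p - e) = 0"
          using p plane[OF v dual] by auto
      qed
      with dual have "\<forall>w\<in>C. r * norm \<beta> + \<beta> \<bullet> (w - e) = of_bool (w = v)" by (simp only:)
      then show "\<exists>\<beta>. \<forall>w\<in>C. r * norm \<beta> + \<beta> \<bullet> (w - e) = of_bool (w = v)" by blast
    qed
  next
    assume dual: "\<forall>v\<in>C. \<exists>\<beta>. \<forall>w\<in>C. r * norm \<beta> + \<beta> \<bullet> (w - e) = of_bool (w = v)"
    \<comment> \<open>By Cauchy-Schwarz every barycentric coordinate is nonnegative on the
      sphere.\<close>
    have sub: "sphere e r \<subseteq> convex hull C"
    proof
      fix x assume x: "x \<in> sphere e r"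
      have "x \<in> affine hull C" using affine_independent_span_eq[OF C] by simp
      then obtain u where u: "sum u C = 1" "(\<Sum>w\<in>C. u w *\<^sub>R w) = x"
        using fin by (auto simp: affine_hull_finite)
      have "0 \<le> u v" if v: "v \<in> C" for v
      proof -
        obtain \<beta> where \<beta>: "\<forall>w\<in>C. r * norm \<beta> + \<beta> \<bullet> (w - e) = of_bool (w = v)"
          using dual v by blast
        have "\<bar>\<beta> \<bullet> (x - e)\<bar> \<le> norm \<beta> * r"
          using Cauchy_Schwarz_ineq2[of \<beta> "x - e"] x by (simp add: dist_norm norm_minus_commute)
        then show ?thesis using coord[OF v \<beta> u(1)] u(2) by (simp add: mult.commute)
      qed
      then show "x \<in> convex hull C" using u fin by (auto simp: convex_hull_finite)
    qed
    moreover have "\<exists>p\<in>F. affine hull F \<inter> sphere e r = {p}" if facet_F: "F facet_of convex hull C" for F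
    proof -
      obtain v where v: "v \<in> C" and F: "F = convex hull (C - {v})" using facet_F unfolding facet by blast
      obtain \<beta> where \<beta>: "\<forall>w\<in>C. r * norm \<beta> + \<beta> \<bullet> (w - e) = of_bool (w = v)"
        using dual v by blast
      have "\<beta> \<noteq> 0" using bspec[OF \<beta> v] by auto
      define p where "p = e - (r / norm \<beta>) *\<^sub>R \<beta>"
      have p: "affine hull F \<inter> sphere e r = {p}"
        by (simp only: F p_def affine_hull_convex_hull plane[OF v \<beta>]
            plane_inter_sphere[OF r \<open>\<beta> \<noteq> 0\<close>])
      then have "p \<in> affine hull (C - {v})" "p \<in> sphere e r" by (auto simp: F)
      \<comment> \<open>The touching point lies in the simplex and its coordinate at
        \<open>v\<close> is zero, so it lies in the facet itself and not merely in its
        plane.\<close>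
      then have "p \<in> convex hull C" and p0: "r * norm \<beta> + \<beta> \<bullet> (p - e) = 0"
        using sub unfolding plane[OF v \<beta>] by blast+
      then obtain u where u: "\<forall>w\<in>C. 0 \<le> u w" "sum u C = 1" "(\<Sum>w\<in>C. u w *\<^sub>R w) = p"
        using fin by (auto simp: convex_hull_finite)
      with coord[OF v \<beta>, of u] p0 have "u v = 0" by simp
      with u have "\<forall>w\<in>C - {v}. 0 \<le> u w" "sum u (C - {v}) = 1" "(\<Sum>w\<in>C - {v}. u w *\<^sub>R w) = p"
        using fin v by (simp_all add: sum.remove[of C v])
      then have "p \<in> F" using fin by (auto simp: F convex_hull_finite)
      with p show ?thesis by blast
    qed
    ultimately show "circumscribed_about (convex hull C) (sphere e r)"
      by (auto simp: circumscribed_about_def)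
  qed
qed

section \<open>Necessity: Lorentz boosts and the resulting bound\<close>

text \<open>
  In Minkowski space: the Lorentz boost with matrix entries \<open>K\<close>, \<open>S\<close> along \<open>u\<close> maps the lightlike
  vector \<open>(a, w)\<close> to a lightlike one, whose product with the lightlike \<open>(R, y)\<close> is nonnegative.
\<close>

lemma boost_inequality:
  fixes w y u :: "'a::real_inner"
  assumes "norm u = 1" "norm y = R" "norm w = a" "K\<^sup>2 - S\<^sup>2 = 1" "0 \<le> K"
  shows "w \<bullet> y + (y \<bullet> u) * (S * a + (K - 1) * (w \<bullet> u)) \<le> R * (K * a + S * (w \<bullet> u))"
proof -
  \<comment> \<open>\<open>z\<close> is the spatial part of the boosted vector; its time part is
    \<open>K * a + S * (w \<bullet> u)\<close>. Since the boost preserves the Minkowski form, the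
    squares of \<open>norm z\<close> and of the time part agree.\<close>
  define z where "z = w + (S * a + (K - 1) * (w \<bullet> u)) *\<^sub>R u"
  have uu: "u \<bullet> u = 1" and ww: "w \<bullet> w = a\<^sup>2"
    using assms by (auto simp: dot_square_norm)
  have S2: "S\<^sup>2 = K\<^sup>2 - 1" using assms by simp
  have "z \<bullet> z = a\<^sup>2 + 2 * (S * a + (K - 1) * (w \<bullet> u)) * (w \<bullet> u) + (S * a + (K - 1) * (w \<bullet> u))\<^sup>2"
    unfolding z_def by (simp add: inner_add_left inner_add_right uu ww inner_commute[of u w]
        algebra_simps power2_eq_square)
  also have "\<dots> = (K * a + S * (w \<bullet> u))\<^sup>2"
    using S2 by algebra
  finally have "(norm z)\<^sup>2 = (K * a + S * (w \<bullet> u))\<^sup>2"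
    by (simp add: dot_square_norm)
  \<comment> \<open>The boost keeps the time part nonnegative, so the squares may be
    dropped.\<close>
  moreover have "0 \<le> K * a + S * (w \<bullet> u)"
  proof -
    have "S\<^sup>2 \<le> K\<^sup>2" using S2 by simp
    hence "\<bar>S\<bar> \<le> K" using \<open>0 \<le> K\<close> by (simp add: abs_le_square_iff[symmetric])
    moreover have "\<bar>w \<bullet> u\<bar> \<le> a" using Cauchy_Schwarz_ineq2[of w u] assms by simp
    ultimately have "\<bar>S * (w \<bullet> u)\<bar> \<le> K * a"
      unfolding abs_mult by (intro mult_mono) (use assms in auto)
    thus ?thesis by linarith
  qed
  ultimately have "norm z = K * a + S * (w \<bullet> u)" by (simp add: power2_eq_iff_nonneg)
  moreover have "y \<bullet> z \<le> R * norm z" using norm_cauchy_schwarz[of y z] assms by simp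
  ultimately show ?thesis
    by (simp add: z_def inner_add_right inner_commute mult.commute)
qed

lemma inscribed_simplex_iff:
  "\<not> affine_dependent C \<Longrightarrow> inscribed_in (convex hull C) S \<longleftrightarrow> C \<subseteq> S"
  by (simp add: inscribed_in_def extreme_point_of_convex_hull_affine_independent)

text \<open>This is \<open>boost_inequality\<close> with \<open>w = r *\<^sub>R \<beta> v\<close>
  and \<open>y = v - b\<close>, summed over the vertices. The coordinates sum to 1 and reproduce
  each point, and this evaluates all the sums.\<close>

lemma boost_bound:
  fixes e b u :: "'a::euclidean_space"
  assumes r: "0 < r" and u: "norm u = 1" "e - b = d *\<^sub>R u" and CS: "K\<^sup>2 - S\<^sup>2 = 1" "0 \<le> K"
    and C: "\<not> affine_dependent C" "card C = Suc (DIM('a))"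
    and circ: "circumscribed_about (convex hull C) (sphere e r)"
    and ins: "inscribed_in (convex hull C) (sphere b R)"
  shows "r * (DIM('a) - 1) \<le> K * (R - r) - S * d"
proof -
  have fin: "finite C" using C(2) by (simp add: card_ge_0_finite)
  have on: "norm (v - b) = R" if "v \<in> C" for v
    using ins that by (auto simp: inscribed_simplex_iff[OF C(1)] dist_norm norm_minus_commute)
  obtain \<beta> where \<beta>: "\<And>v w. v \<in> C \<Longrightarrow> w \<in> C \<Longrightarrow>
      r * norm (\<beta> v) + \<beta> v \<bullet> (w - e) = of_bool (w = v)"
    using circ unfolding circumscribed_simplex_iff[OF r C] by metis
  define \<mu> where "\<mu> v x = r * norm (\<beta> v) + \<beta> v \<bullet> (x - e)" for v x
  have bary: "(\<Sum>v\<in>C. \<mu> v x) = 1 \<and> (\<Sum>v\<in>C. \<mu> v x *\<^sub>R v) = x" for x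
  proof -
    have "x \<in> affine hull C" using affine_independent_span_eq[OF C] by simp
    then obtain t where t: "sum t C = 1" "(\<Sum>w\<in>C. t w *\<^sub>R w) = x"
      using fin by (auto simp: affine_hull_finite)
    have "\<mu> v x = t v" if "v \<in> C" for v
      using affine_functional_sum[OF fin t(1) \<beta>] that t(2) by (auto simp: \<mu>_def)
    with t show ?thesis by simp
  qed
  define a where "a v = r * norm (\<beta> v)" for v
  have a: "\<mu> v e = a v" for v by (simp add: \<mu>_def a_def)
  have diff: "\<beta> v \<bullet> x = \<mu> v (e + x) - \<mu> v e" for v x by (simp add: \<mu>_def)
  have sum_\<beta>: "(\<Sum>v\<in>C. \<beta> v \<bullet> x) = 0" for x
    using bary by (simp add: diff sum_subtractf)
  have mom_a: "(\<Sum>v\<in>C. a v *\<^sub>R (v - b)) = e - b"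
    using bary[of e] by (simp add: a scaleR_diff_right sum_subtractf flip: scaleR_left.sum)
  \<comment> \<open>The sum of the tensors of \<open>\<beta> v\<close> and \<open>v - b\<close> is
    the identity map; below, its trace is the dimension and its entry along \<open>u\<close> is
    1.\<close>
  have mom_\<beta>: "(\<Sum>v\<in>C. (\<beta> v \<bullet> x) *\<^sub>R (v - b)) = x" for x
  proof -
    have "(\<Sum>v\<in>C. (\<beta> v \<bullet> x) *\<^sub>R (v - b)) = (\<Sum>v\<in>C. (\<beta> v \<bullet> x) *\<^sub>R v)"
      by (simp add: scaleR_diff_right sum_subtractf sum_\<beta> flip: scaleR_left.sum)
    also have "\<dots> = x" using bary
      by (simp add: diff scaleR_diff_left sum_subtractf)
    finally show ?thesis .
  qed
  have uu: "u \<bullet> u = 1" using u by (simp add: dot_square_norm)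
  have "(\<Sum>v\<in>C. \<beta> v \<bullet> (v - b)) = (\<Sum>v\<in>C. \<Sum>i\<in>Basis. (\<beta> v \<bullet> i) * ((v - b) \<bullet> i))"
    by (intro sum.cong refl euclidean_inner)
  also have "\<dots> = (\<Sum>i\<in>Basis. (\<Sum>v\<in>C. (\<beta> v \<bullet> i) *\<^sub>R (v - b)) \<bullet> i)"
    by (subst sum.swap) (simp add: inner_sum_left)
  also have "\<dots> = DIM('a)" by (simp add: mom_\<beta>)
  finally have trace: "(\<Sum>v\<in>C. \<beta> v \<bullet> (v - b)) = DIM('a)" .
  have m1: "(\<Sum>v\<in>C. ((v - b) \<bullet> u) * a v) = d"
    using arg_cong[OF mom_a, of "\<lambda>x. x \<bullet> u"] by (simp add: inner_sum_left u(2) uu mult.commute)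
  have m2: "(\<Sum>v\<in>C. ((v - b) \<bullet> u) * (\<beta> v \<bullet> u)) = 1"
    using arg_cong[OF mom_\<beta>[of u], of "\<lambda>x. x \<bullet> u"] by (simp add: inner_sum_left uu mult.commute)
  have "(\<Sum>v\<in>C. (r *\<^sub>R \<beta> v) \<bullet> (v - b) + ((v - b) \<bullet> u) * (S * a v + (K - 1) * ((r *\<^sub>R \<beta> v) \<bullet> u)))
      \<le> (\<Sum>v\<in>C. R * (K * a v + S * ((r *\<^sub>R \<beta> v) \<bullet> u)))"
    by (intro sum_mono boost_inequality u CS on) (use r in \<open>auto simp: a_def\<close>)
  also have "\<dots> = R * K * (\<Sum>v\<in>C. a v) + R * S * r * (\<Sum>v\<in>C. \<beta> v \<bullet> u)"
    by (simp add: sum_distrib_left sum.distrib algebra_simps)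
  also have "\<dots> = R * K" using bary[of e] by (simp add: sum_\<beta> a)
  also have "(\<Sum>v\<in>C. (r *\<^sub>R \<beta> v) \<bullet> (v - b) + ((v - b) \<bullet> u) * (S * a v + (K - 1) * ((r *\<^sub>R \<beta> v) \<bullet> u)))
    = r * (\<Sum>v\<in>C. \<beta> v \<bullet> (v - b)) + S * (\<Sum>v\<in>C. ((v - b) \<bullet> u) * a v)
      + (K - 1) * r * (\<Sum>v\<in>C. ((v - b) \<bullet> u) * (\<beta> v \<bullet> u))"
    unfolding sum_distrib_left sum.distrib[symmetric] by (intro sum.cong refl) (simp add: distrib_left mult_ac)
  also have "\<dots> = r * DIM('a) + S * d + (K - 1) * r" by (simp add: trace m1 m2)
  finally show ?thesis using DIM_positive[where 'a='a]
    by (simp add: of_nat_diff Suc_le_eq algebra_simps)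
qed

text \<open>For \<open>x = 0\<close> any unit vector serves, so concentric spheres need no separate
  treatment.\<close>

lemma exists_unit_direction:
  fixes x :: "'a::euclidean_space"
  obtains u where "norm u = 1" "x = norm x *\<^sub>R u"
proof (cases "x = 0")
  case True
  obtain i :: 'a where "i \<in> Basis" by fastforce
  with True show ?thesis by (intro that[of i]) auto
next
  case False
  then show ?thesis by (intro that[of "x /\<^sub>R norm x"]) auto
qed

text \<open>Writing \<open>K\<close> and \<open>S\<close> as hyperbolic cosine and sine turns
  \<open>boost_bound\<close> into a quadratic inequality in \<open>x > 0\<close>. The chosen value
  of \<open>x\<close> avoids dividing by \<open>R - r - d\<close>, whose sign is not yet known, and
  yields \<open>(m * r)\<^sup>2 \<le> (R - r)\<^sup>2 - d\<^sup>2\<close>, which factors into the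
  claim.\<close>

proposition dist_incentre_circumcentre_le:
  fixes e b :: "'a::euclidean_space"
  assumes r: "0 < r" and dim: "2 \<le> DIM('a)"
    and C: "\<not> affine_dependent C" "card C = Suc (DIM('a))"
    and circ: "circumscribed_about (convex hull C) (sphere e r)"
    and ins: "inscribed_in (convex hull C) (sphere b R)"
  shows "(dist e b)\<^sup>2 \<le> (R + (real DIM('a) - 2) * r) * (R - real DIM('a) * r)"
proof -
  define d where "d = dist e b"
  define m where "m = real DIM('a) - 1"
  have m: "1 \<le> m" using dim by (simp add: m_def)
  obtain u where u: "norm u = 1" "e - b = d *\<^sub>R u"
    using exists_unit_direction[of "e - b"] by (auto simp: d_def dist_norm)
  \<comment> \<open>\<open>x\<close> is the exponential of the rapidity of the boost.\<close>
  have key: "2 * m * r * x \<le> (R - r - d) * x\<^sup>2 + (R - r + d)" if x: "0 < x" for x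
  proof -
    have "((x + 1 / x) / 2)\<^sup>2 - ((x - 1 / x) / 2)\<^sup>2 = 1"
      using x by (simp add: power2_eq_square field_simps)
    from boost_bound[OF r u this _ C circ ins] x dim
    have "r * m \<le> (x + 1 / x) / 2 * (R - r) - (x - 1 / x) / 2 * d"
      by (simp add: m_def of_nat_diff)
    then have "r * m * (2 * x) \<le> ((x + 1 / x) / 2 * (R - r) - (x - 1 / x) / 2 * d) * (2 * x)"
      using x by (intro mult_right_mono) auto
    also have "\<dots> = (R - r - d) * x\<^sup>2 + (R - r + d)"
      using x by (simp add: power2_eq_square field_simps)
    finally show ?thesis by (simp add: mult_ac)
  qed
  have mr: "0 < m * r" using m r by simp
  \<comment> \<open>At \<open>x = 1\<close> the boost is the identity.\<close>
  have "0 < R - r" using key[of 1] mr by simp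
  then have B: "0 < R - r + d" by (simp add: d_def add_pos_nonneg)
  \<comment> \<open>the value of \<open>x\<close> at which \<open>key\<close> becomes the claim\<close>
  define y where "y = (R - r + d) / (m * r)"
  have y: "0 < y" "R - r + d = y * (m * r)" using B mr m r by (simp_all add: y_def)
  have "y * (m * r) \<le> y * ((R - r - d) * y)"
  proof -
    have "2 * m * r * y = 2 * (y * (m * r))" "(R - r - d) * y\<^sup>2 = y * ((R - r - d) * y)"
      by (simp_all add: power2_eq_square)
    then show ?thesis using key[OF y(1)] y(2) by linarith
  qed
  then have "m * r \<le> (R - r - d) * y" using y(1) by simp
  then have "(m * r) * (m * r) \<le> (R - r - d) * y * (m * r)" using mr by (intro mult_right_mono) auto
  then have "(m * r)\<^sup>2 \<le> (R - r - d) * (R - r + d)"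
    by (simp add: y(2) power2_eq_square mult_ac)
  then show ?thesis
    by (simp add: m_def d_def[symmetric] power2_eq_square algebra_simps)
qed

section \<open>Sufficiency: a symmetric tetrahedron\<close>

text \<open>
  The vertices of the tetrahedron will be \<open>h1 *\<^sub>R u \<plusminus> p *\<^sub>R f\<close> and \<open>h2 *\<^sub>R u \<plusminus> q *\<^sub>R g\<close> for orthonormal
  \<open>u\<close>, \<open>f\<close>, \<open>g\<close>, with the incentre at \<open>0\<close> and the circumcentre at \<open>d *\<^sub>R u\<close>. The two equations express
  tangency of the faces after \<open>p\<close> and \<open>q\<close> are eliminated by means of the circumsphere.
\<close>

lemma exists_heights:
  fixes r R d :: real
  assumes "0 < r" "0 < R" "0 \<le> d" "d\<^sup>2 \<le> (R + r) * (R - 3 * r)"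
  obtains h1 h2 where "r < h1" "h2 < - r"
    "(R\<^sup>2 - (h2 - d)\<^sup>2) * (h1\<^sup>2 - r\<^sup>2) = r\<^sup>2 * (h1 - h2)\<^sup>2"
    "(R\<^sup>2 - (h1 - d)\<^sup>2) * (h2\<^sup>2 - r\<^sup>2) = r\<^sup>2 * (h1 - h2)\<^sup>2"
proof -
  \<comment> \<open>With \<open>s = h1 + h2\<close> and \<open>w = h1 * h2 + r\<^sup>2\<close>, the difference of the equations is linear in \<open>s\<close>;
    eliminating \<open>s\<close> leaves \<open>w\<^sup>2 + M * w + 4 * r^4 = 0\<close>, which is solvable exactly under the hypothesis.\<close>
  define k where "k = R\<^sup>2 - d\<^sup>2 - r\<^sup>2"
  have "0 \<le> (R + r) * (R - 3 * r)" using assms(4) by (meson order_trans zero_le_power2)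
  hence R3: "3 * r \<le> R" using assms by (simp add: zero_le_mult_iff)
  \<comment> \<open>The hypothesis reads
    \<open>d\<^sup>2 \<le> (R - r)\<^sup>2 - 4 * r\<^sup>2\<close>, so the inner sphere lies
    strictly inside the outer one.\<close>
  have "(d + r)\<^sup>2 < R\<^sup>2"
  proof -
    have "d\<^sup>2 < (R - r)\<^sup>2"
      using assms(1,4) by (simp add: power2_eq_square algebra_simps)
        (smt (verit) mult_pos_pos)
    hence "d < R - r" using R3 assms(1) by (simp add: power2_less_imp_less)
    thus ?thesis using assms by (intro power_strict_mono) auto
  qed
  hence k: "2 * d * r < k" by (simp add: k_def power2_eq_square algebra_simps)
  hence k0: "0 < k" using assms by (smt (verit) mult_nonneg_nonneg)
  define M where "M = k - 4 * r\<^sup>2 - 4 * d\<^sup>2 * r\<^sup>2 / k"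
  \<comment> \<open>This is the hypothesis rearranged. Squared, it gives
    \<open>4 * r\<^sup>2 \<le> M\<close>, which makes the discriminant of the quadratic in
    \<open>w\<close> nonnegative.\<close>
  have "2 * R * r \<le> k - 2 * r\<^sup>2"
    using assms(4) by (simp add: k_def power2_eq_square algebra_simps)
  hence "(2 * R * r)\<^sup>2 \<le> (k - 2 * r\<^sup>2)\<^sup>2" using assms by (intro power_mono) auto
  moreover have "(k - 2 * r\<^sup>2)\<^sup>2 - (2 * R * r)\<^sup>2 = k * (M - 4 * r\<^sup>2)"
    using k0 by (simp add: M_def field_simps) (simp add: k_def algebra_simps power2_eq_square)
  ultimately have M: "4 * r\<^sup>2 \<le> M" using k0 by (smt (verit) zero_le_mult_iff)
  define w where "w = - (M + sqrt (M\<^sup>2 - 16 * r^4)) / 2"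
  have "(4 * r\<^sup>2)\<^sup>2 \<le> M\<^sup>2" using M by (intro power_mono) auto
  hence disc: "0 \<le> M\<^sup>2 - 16 * r^4" by (simp add: power_mult_distrib)
  have w: "w\<^sup>2 + M * w + 4 * r^4 = 0"
    using real_sqrt_pow2[OF disc] unfolding w_def by (simp add: field_simps power2_eq_square)
  have "0 < M" using M assms by (smt (verit) zero_less_power)
  hence "0 < M + sqrt (M\<^sup>2 - 16 * r^4)" using real_sqrt_ge_zero[OF disc] by (rule add_pos_nonneg)
  hence w0: "w < 0" by (simp add: w_def)
  define s where "s = - 2 * d * w / k"
  \<comment> \<open>\<open>P\<close> is the intended product \<open>h1 * h2\<close>. Being negative,
    it gives the quadratic with root sum \<open>s\<close> and root product \<open>P\<close> two
    distinct real roots.\<close>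
  define P where "P = w - r\<^sup>2"
  have s: "k * s = - 2 * d * w" using k0 by (simp add: s_def)
  have ws: "w\<^sup>2 + (k - 4 * r\<^sup>2) * w + 2 * d * r\<^sup>2 * s + 4 * r^4 = 0"
    using w k0 by (simp add: M_def s_def field_simps power2_eq_square)
  have "P < 0" using w0 by (smt (verit) P_def zero_le_power2)
  have disc': "0 < s\<^sup>2 - 4 * P" using \<open>P < 0\<close> by (smt (verit) zero_le_power2)
  define D where "D = sqrt (s\<^sup>2 - 4 * P)"
  have D2: "D\<^sup>2 = s\<^sup>2 - 4 * P" and D0: "0 < D" using disc' by (simp_all add: D_def)
  define h1 where "h1 = (s + D) / 2"
  define h2 where "h2 = (s - D) / 2"
  have sum: "h1 + h2 = s" and prod: "h1 * h2 = P"
    using D2 by (auto simp: h1_def h2_def field_simps power2_eq_square)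
  have h: "h2 < h1" using D0 by (simp add: h1_def h2_def)
  \<comment> \<open>A negative product places \<open>r\<close> strictly between \<open>h2\<close>
    and \<open>h1\<close>; the same is then done for \<open>- r\<close>.\<close>
  have "k * ((h1 - r) * (h2 - r)) = w * (k + 2 * d * r)"
    using s sum prod by (simp add: P_def) algebra
  also have "\<dots> < 0" using w0 k0 assms by (intro mult_neg_pos) (auto intro: add_pos_nonneg)
  finally have "(h1 - r) * (h2 - r) < 0" using k0 by (simp add: mult_less_0_iff)
  hence h1: "r < h1" using h by (auto simp: mult_less_0_iff)
  have "k * ((h1 + r) * (h2 + r)) = w * (k - 2 * d * r)"
    using s sum prod by (simp add: P_def) algebra
  also have "\<dots> < 0" using w0 k by (intro mult_neg_pos) auto
  finally have "(h1 + r) * (h2 + r) < 0" using k0 by (simp add: mult_less_0_iff)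
  hence h2: "h2 < - r" using h by (auto simp: mult_less_0_iff)
  define E1 where "E1 = (R\<^sup>2 - (h2 - d)\<^sup>2) * (h1\<^sup>2 - r\<^sup>2) - r\<^sup>2 * (h1 - h2)\<^sup>2"
  define E2 where "E2 = (R\<^sup>2 - (h1 - d)\<^sup>2) * (h2\<^sup>2 - r\<^sup>2) - r\<^sup>2 * (h1 - h2)\<^sup>2"
  have wh: "w = h1 * h2 + r\<^sup>2" using prod by (simp add: P_def)
  have "E1 - E2 = (h1 - h2) * (k * s + 2 * d * w)"
    unfolding E1_def E2_def k_def wh sum[symmetric] by algebra
  hence "E1 = E2" using s by simp
  moreover have "E1 + E2 = s * (k * s + 2 * d * w)
      - 2 * (w\<^sup>2 + (k - 4 * r\<^sup>2) * w + 2 * d * r\<^sup>2 * s + 4 * r^4)"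
    unfolding E1_def E2_def k_def wh sum[symmetric] by algebra
  hence "E1 + E2 = 0" using s ws by simp
  ultimately have "E1 = 0" "E2 = 0" by auto
  with h1 h2 show ?thesis by (intro that[of h1 h2]) (auto simp: E1_def E2_def)
qed

lemma orthonormal_triple:
  fixes u :: "'a::euclidean_space"
  assumes "DIM('a) = 3" "norm u = 1"
  obtains f g where "u \<bullet> u = 1" "f \<bullet> f = 1" "g \<bullet> g = 1" "u \<bullet> f = 0" "u \<bullet> g = 0" "f \<bullet> g = 0"
proof -
  obtain S where S: "u \<in> S" "pairwise orthogonal S" "\<And>x. x \<in> S \<Longrightarrow> norm x = 1" "card S = DIM('a)"
    using vector_in_orthonormal_basis[OF assms(2)] by metis
  then have "card (S - {u}) = 2" using assms(1) by simp
  then obtain f g where fg: "S - {u} = {f, g}" "f \<noteq> g" by (auto simp: card_2_iff)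
  then have mem: "f \<in> S" "g \<in> S" "u \<noteq> f" "u \<noteq> g" by auto
  show ?thesis
    using S mem fg(2) by (intro that[of f g]) (auto simp: pairwise_def orthogonal_def dot_square_norm)
qed

text \<open>Explicit gradients of the four barycentric coordinates settle tangency by
  \<open>circumscribed_simplex_iff\<close> and affine independence by duality. The equations for the
  heights then put the vertices on the outer sphere.\<close>

proposition exists_circumscribed_inscribed_tetrahedron:
  fixes e b :: "'a::euclidean_space"
  assumes dim: "DIM('a) = 3" and r: "0 < r" and R: "0 < R"
    and le: "(dist e b)\<^sup>2 \<le> (R + r) * (R - 3 * r)"
  obtains C where "\<not> affine_dependent C" "card C = 4"
    "circumscribed_about (convex hull C) (sphere e r)"
    "inscribed_in (convex hull C) (sphere b R)"
proof -
  define d where "d = dist e b"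
  obtain u where u: "norm u = 1" "b - e = d *\<^sub>R u"
    using exists_unit_direction[of "b - e"] by (auto simp: d_def dist_norm norm_minus_commute)
  obtain f g where uu: "u \<bullet> u = 1" "f \<bullet> f = 1" "g \<bullet> g = 1" "u \<bullet> f = 0" "u \<bullet> g = 0" "f \<bullet> g = 0"
    using orthonormal_triple[OF dim u(1)] by blast
  then have orth: "f \<bullet> u = 0" "g \<bullet> u = 0" "g \<bullet> f = 0" by (simp_all add: inner_commute)
  obtain h1 h2 where h: "r < h1" "h2 < - r"
    "(R\<^sup>2 - (h2 - d)\<^sup>2) * (h1\<^sup>2 - r\<^sup>2) = r\<^sup>2 * (h1 - h2)\<^sup>2"
    "(R\<^sup>2 - (h1 - d)\<^sup>2) * (h2\<^sup>2 - r\<^sup>2) = r\<^sup>2 * (h1 - h2)\<^sup>2"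
    using exists_heights[OF r R, of d] le by (auto simp: d_def)
  define H where "H = h1 - h2"
  have H: "0 < H" using h r by (simp add: H_def)
  have "r\<^sup>2 < h1\<^sup>2" using h(1) r by (intro power_strict_mono) auto
  then have h1: "0 < h1\<^sup>2 - r\<^sup>2" by simp
  have "r\<^sup>2 < (- h2)\<^sup>2" using h(2) r by (intro power_strict_mono) auto
  then have h2: "0 < h2\<^sup>2 - r\<^sup>2" by simp
  \<comment> \<open>These half-lengths of the two opposite edges are forced by tangency: they make
    \<open>norm_\<beta>\<close> and \<open>norm_\<gamma>\<close> below hold.\<close>
  define p where "p = sqrt (r\<^sup>2 * H\<^sup>2 / (h2\<^sup>2 - r\<^sup>2))"
  define q where "q = sqrt (r\<^sup>2 * H\<^sup>2 / (h1\<^sup>2 - r\<^sup>2))"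
  have p: "0 < p" and q: "0 < q" using r H h1 h2 by (simp_all add: p_def q_def)
  have p2: "p\<^sup>2 = r\<^sup>2 * H\<^sup>2 / (h2\<^sup>2 - r\<^sup>2)" and q2: "q\<^sup>2 = r\<^sup>2 * H\<^sup>2 / (h1\<^sup>2 - r\<^sup>2)"
    using h1 h2 by (simp_all add: p_def q_def)
  define A where "A s = e + h1 *\<^sub>R u + (s * p) *\<^sub>R f" for s :: real
  define B where "B s = e + h2 *\<^sub>R u + (s * q) *\<^sub>R g" for s :: real
  define C where "C = {A 1, A (- 1), B 1, B (- 1)}"
  have "(A s - e) \<bullet> u = h1" "(B s - e) \<bullet> u = h2" for s
    by (simp_all add: A_def B_def inner_add_left uu orth)
  then have AB: "A s \<noteq> B t" for s t using h r by (metis less_trans neg_less_0_iff_less not_less_iff_gr_or_eq)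
  have Af: "(A s - e) \<bullet> f = s * p" and Bg: "(B s - e) \<bullet> g = s * q" for s
    by (simp_all add: A_def B_def inner_add_left uu orth)
  have "A 1 \<noteq> A (- 1)" using Af[of 1] Af[of "- 1"] p by auto
  moreover have "B 1 \<noteq> B (- 1)" using Bg[of 1] Bg[of "- 1"] q by auto
  ultimately have distinct: "A 1 \<noteq> A (- 1)" "A (- 1) \<noteq> A 1" "B 1 \<noteq> B (- 1)" "B (- 1) \<noteq> B 1"
    "A s \<noteq> B t" "B t \<noteq> A s" for s t using AB by metis+
  \<comment> \<open>For \<open>s\<close> equal to 1 or -1, \<open>\<beta> s\<close> and
    \<open>\<gamma> s\<close> are the gradients of the barycentric coordinates of \<open>A s\<close>
    and \<open>B s\<close>.\<close>
  define \<beta> where "\<beta> s = (1 / (2 * H)) *\<^sub>R u + (s / (2 * p)) *\<^sub>R f" for s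
  define \<gamma> where "\<gamma> s = (- 1 / (2 * H)) *\<^sub>R u + (s / (2 * q)) *\<^sub>R g" for s
  have norm_\<beta>: "r * norm (\<beta> s) = - h2 / (2 * H)" if "s\<^sup>2 = 1" for s
  proof -
    have "(norm (\<beta> s))\<^sup>2 = 1 / (4 * H\<^sup>2) + 1 / (4 * p\<^sup>2)"
      unfolding \<beta>_def power2_norm_eq_inner using that
      by (simp add: inner_add_left inner_add_right uu orth power2_eq_square)
    then have "(r * norm (\<beta> s))\<^sup>2 = (- h2 / (2 * H))\<^sup>2"
      using r H h2 by (simp add: p2 power_mult_distrib power_divide field_simps)
    moreover have "0 \<le> - h2 / (2 * H)" using r H h by (intro divide_nonneg_pos) auto
    ultimately show ?thesis
      using r by (subst (asm) power2_eq_iff_nonneg) auto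
  qed
  have norm_\<gamma>: "r * norm (\<gamma> s) = h1 / (2 * H)" if "s\<^sup>2 = 1" for s
  proof -
    have "(norm (\<gamma> s))\<^sup>2 = 1 / (4 * H\<^sup>2) + 1 / (4 * q\<^sup>2)"
      unfolding \<gamma>_def power2_norm_eq_inner using that
      by (simp add: inner_add_left inner_add_right inner_diff_left inner_diff_right uu orth power2_eq_square)
    then have "(r * norm (\<gamma> s))\<^sup>2 = (h1 / (2 * H))\<^sup>2"
      using r H h1 by (simp add: q2 power_mult_distrib power_divide field_simps)
    moreover have "0 \<le> h1 / (2 * H)" using r H h by (intro divide_nonneg_pos) auto
    ultimately show ?thesis
      using r by (subst (asm) power2_eq_iff_nonneg) auto
  qed
  have "\<beta> s \<bullet> (A t - e) = h1 / (2 * H) + s * t / 2" "\<beta> s \<bullet> (B t - e) = h2 / (2 * H)"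
    "\<gamma> s \<bullet> (A t - e) = - h1 / (2 * H)" "\<gamma> s \<bullet> (B t - e) = - h2 / (2 * H) + s * t / 2" for s t
    using p q by (simp_all add: \<beta>_def \<gamma>_def A_def B_def inner_add_left inner_add_right
        inner_diff_left uu orth)
  moreover have "h1 / (2 * H) - h2 / (2 * H) = 1 / 2"
    using H by (simp add: H_def flip: diff_divide_distrib)
  ultimately have \<beta>A: "r * norm (\<beta> s) + \<beta> s \<bullet> (A t - e) = (1 + s * t) / 2"
    and \<beta>B: "r * norm (\<beta> s) + \<beta> s \<bullet> (B t - e) = 0"
    and \<gamma>A: "r * norm (\<gamma> s) + \<gamma> s \<bullet> (A t - e) = 0"
    and \<gamma>B: "r * norm (\<gamma> s) + \<gamma> s \<bullet> (B t - e) = (1 + s * t) / 2" if "s\<^sup>2 = 1" for s t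
    by (simp_all add: norm_\<beta>[OF that] norm_\<gamma>[OF that] add_divide_distrib)
  have dual: "\<exists>\<beta>. \<forall>w\<in>C. r * norm \<beta> + \<beta> \<bullet> (w - e) = of_bool (w = v)" if "v \<in> C" for v
  proof -
    consider "v = A 1" | "v = A (- 1)" | "v = B 1" | "v = B (- 1)"
      using \<open>v \<in> C\<close> by (auto simp: C_def)
    then show ?thesis
    proof cases
      case 1
      then show ?thesis by (intro exI[of _ "\<beta> 1"]) (simp add: C_def \<beta>A \<beta>B distinct)
    next
      case 2
      then show ?thesis by (intro exI[of _ "\<beta> (- 1)"]) (simp add: C_def \<beta>A \<beta>B distinct)
    next
      case 3
      then show ?thesis by (intro exI[of _ "\<gamma> 1"]) (simp add: C_def \<gamma>A \<gamma>B distinct)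
    next
      case 4
      then show ?thesis by (intro exI[of _ "\<gamma> (- 1)"]) (simp add: C_def \<gamma>A \<gamma>B distinct)
    qed
  qed
  have card: "card C = 4" by (simp add: C_def distinct)
  have indep: "\<not> affine_dependent C"
  proof (rule affine_independent_if_dual)
    show "finite C" by (simp add: C_def)
    fix v assume "v \<in> C"
    then obtain \<beta> where "\<forall>w\<in>C. r * norm \<beta> + \<beta> \<bullet> (w - e) = of_bool (w = v)" using dual by blast
    then have "\<forall>w\<in>C. (r * norm \<beta> - \<beta> \<bullet> e) + \<beta> \<bullet> w = of_bool (w = v)"
      by (auto simp: inner_diff_right add_diff_eq diff_add_eq)
    then show "\<exists>\<alpha> \<beta>. \<forall>w\<in>C. \<alpha> + \<beta> \<bullet> w = of_bool (w = v)" by blast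
  qed
  have b: "b = e + d *\<^sub>R u" using u(2) by (simp add: algebra_simps)
  have "(dist b (A s))\<^sup>2 = R\<^sup>2" if "s\<^sup>2 = 1" for s
  proof -
    have "A s - b = (h1 - d) *\<^sub>R u + (s * p) *\<^sub>R f" by (simp add: A_def b algebra_simps)
    then have "(dist b (A s))\<^sup>2 = (norm ((h1 - d) *\<^sub>R u + (s * p) *\<^sub>R f))\<^sup>2"
      by (simp add: dist_norm norm_minus_commute[of b])
    also have "\<dots> = (h1 - d)\<^sup>2 + s\<^sup>2 * p\<^sup>2"
      unfolding power2_norm_eq_inner
      by (simp add: inner_add_left inner_add_right uu orth power2_eq_square)
    also have "\<dots> = (h1 - d)\<^sup>2 + p\<^sup>2" using that by simp
    also have "\<dots> = R\<^sup>2"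
    proof -
      \<comment> \<open>The second height equation, divided by
        \<open>h2\<^sup>2 - r\<^sup>2\<close>, is precisely this.\<close>
      have "R\<^sup>2 - (h1 - d)\<^sup>2 = p\<^sup>2" using h(4) h2 unfolding p2 H_def by (subst eq_divide_eq) auto
      then show ?thesis by simp
    qed
    finally show ?thesis .
  qed
  moreover have "(dist b (B s))\<^sup>2 = R\<^sup>2" if "s\<^sup>2 = 1" for s
  proof -
    have "B s - b = (h2 - d) *\<^sub>R u + (s * q) *\<^sub>R g" by (simp add: B_def b algebra_simps)
    then have "(dist b (B s))\<^sup>2 = (norm ((h2 - d) *\<^sub>R u + (s * q) *\<^sub>R g))\<^sup>2"
      by (simp add: dist_norm norm_minus_commute[of b])
    also have "\<dots> = (h2 - d)\<^sup>2 + s\<^sup>2 * q\<^sup>2"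
      unfolding power2_norm_eq_inner
      by (simp add: inner_add_left inner_add_right uu orth power2_eq_square)
    also have "\<dots> = (h2 - d)\<^sup>2 + q\<^sup>2" using that by simp
    also have "\<dots> = R\<^sup>2"
    proof -
      have "R\<^sup>2 - (h2 - d)\<^sup>2 = q\<^sup>2" using h(3) h1 unfolding q2 H_def by (subst eq_divide_eq) auto
      then show ?thesis by simp
    qed
    finally show ?thesis .
  qed
  ultimately have "C \<subseteq> sphere b R" using R by (simp add: C_def power2_eq_iff_nonneg)
  then have "inscribed_in (convex hull C) (sphere b R)"
    by (simp add: inscribed_simplex_iff[OF indep])
  moreover have "circumscribed_about (convex hull C) (sphere e r)"
    using circumscribed_simplex_iff[OF r indep] card dim dual by simp
  ultimately show ?thesis using that indep card by blast
qed

theorem corollary3: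
  fixes e b :: "real ^ 3" and r R d :: real
  assumes "0 < r" and "0 < R"
    and "sphere e r \<subseteq> cball b R"
    and "d = dist e b"
  shows "(\<exists>T. 3 simplex T \<and> circumscribed_about T (sphere e r) \<and> inscribed_in T (sphere b R))
         \<longleftrightarrow> d\<^sup>2 \<le> (R + r) * (R - 3 * r)"
proof
  assume "\<exists>T. 3 simplex T \<and> circumscribed_about T (sphere e r) \<and> inscribed_in T (sphere b R)"
  then obtain C :: "(real ^ 3) set" where "\<not> affine_dependent C" "card C = 4"
    "circumscribed_about (convex hull C) (sphere e r)" "inscribed_in (convex hull C) (sphere b R)"
    by (auto simp: simplex_def)
  then show "d\<^sup>2 \<le> (R + r) * (R - 3 * r)"
    \<comment> \<open>In dimension 3 the general factors become \<open>R + r\<close> and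
      \<open>R - 3 * r\<close>.\<close>
    using dist_incentre_circumcentre_le[of r C e b R] assms by simp
next
  assume "d\<^sup>2 \<le> (R + r) * (R - 3 * r)"
  with assms obtain C :: "(real ^ 3) set" where "\<not> affine_dependent C" "card C = 4"
    "circumscribed_about (convex hull C) (sphere e r)" "inscribed_in (convex hull C) (sphere b R)"
    using exists_circumscribed_inscribed_tetrahedron[of r R e b] by auto
  then show "\<exists>T. 3 simplex T \<and> circumscribed_about T (sphere e r) \<and> inscribed_in T (sphere b R)"
    by (intro exI[of _ "convex hull C"]) (auto simp: simplex_def)
qed

end
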